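(* Let $A(z)=\prod_{j=1}^{n}(z-\alpha_j)^{m_j}$, where $\alpha_1,\dots,\alpha_n\in\mathbb{C}$ are distinct, the $m_j$ are positive integers, and $N=\sum_{j=1}^n m_j\geq 1$. Fix $K\in\mathbb{N}$. Then there is a constant $C>0$, depending only on $A$ and $K$, such that for every $L\geq 1$, every $\delta>0$ and all polynomials $B_1,\dots,B_L\in\mathscr{P}_K$ satisfying (a) $\sum_{j=1}^{L}\|B_j\|^2\leq 1$, and (b) $\sum_{j=1}^{L}|B_j(\alpha_i)|^2\geq\delta^2>0$ for all $1\leq i\leq n$, there exist $R\in\mathscr{P}_{K-1}$ and $S_1,\dots,S_L\in\mathscr{P}_{N-1}$ such that $$RA+S_1B_1+\dots+S_LB_L\equiv 1$$ and $$\Big(\|R\|^2+\sum_{j=1}^{L}\|S_j\|^2\Big)^{1/2}\leq\frac{C}{\delta^{\max_i m_i}}.$$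
   Context: $\mathscr{P}_M=\{p\in\mathbb{C}[z]:\deg p\leq M\}$ (with $\mathscr{P}_{-1}=\{0\}$). For a polynomial $p(z)=\sum_{j=0}^{n}p_jz^j$, $\|p\|:=\max_{0\leq j\leq n}|p_j|$. *)

theory Defs
  imports Complex_Main "HOL-Computational_Algebra.Polynomial"
begin

(* The index is an integer so that M = -1 is meaningful; since the library sets degree 0 = 0,
   the zero polynomial is admitted explicitly, which makes poly_space (-1) = {0}. *)
definition poly_space :: "int \<Rightarrow> complex poly set" where
  "poly_space M = {p. p = 0 \<or> int (degree p) \<le> M}"

definition coeff_norm :: "complex poly \<Rightarrow> real" where
  "coeff_norm p = Max ((\<lambda>j. cmod (coeff p j)) ` {0..degree p})"

end

(* At a single node alpha_i put b_j = B_j(alpha_i) and c_j = cnj b_j / sum_j |b_j|^2.  Then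
   T = sum_j c_j B_j takes the value 1 at alpha_i, so 1 - T vanishes there and the truncated
   Neumann series sum_{k<m_i} (1 - T)^k inverts T modulo (z - alpha_i)^(m_i).  Since the l2 norm
   of c is at most 1/delta and T has norm O(1/delta), this local solution has norm
   O(delta^(-m_i)).  The local solutions are glued by a fixed partition of unity for the coprime
   factors of A and reduced modulo A, which on polynomials of bounded degree is a bounded linear
   map depending only on A; R is then the exact quotient. *)
theory Submission
  imports Defs "HOL-Computational_Algebra.Polynomial_Factorial"
    "HOL-Computational_Algebra.Field_as_Ring" "HOL-Analysis.Convex"
begin

section \<open>The coefficient l1 norm and its comparison with \<open>coeff_norm\<close>\<close>

text \<open>Unlike \<open>coeff_norm\<close>, this norm is submultiplicative, so powers of a
  polynomial can be estimated without constants that grow with the degree. On polynomials of bounded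
  degree the two norms are equivalent.\<close>

definition l1_norm :: "complex poly \<Rightarrow> real" where
  "l1_norm p = sum_list (map cmod (coeffs p))"

lemma l1_norm_0 [simp]: "l1_norm 0 = 0"
  by (simp add: l1_norm_def)

lemma l1_norm_1 [simp]: "l1_norm 1 = 1"
  by (simp add: l1_norm_def)

lemma l1_norm_pCons [simp]: "l1_norm (pCons a p) = cmod a + l1_norm p"
  by (simp add: l1_norm_def cCons_def)

lemma l1_norm_nonneg [simp]: "0 \<le> l1_norm p"
  by (induction p) auto

lemma l1_norm_add: "l1_norm (p + q) \<le> l1_norm p + l1_norm q"
proof (induction p q rule: poly_induct2)
  case (pCons a p b q)
  then show ?case using norm_triangle_ineq[of a b] by simp
qed simp

lemma l1_norm_smult [simp]: "l1_norm (smult c p) = cmod c * l1_norm p"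
  by (induction p) (auto simp: norm_mult algebra_simps)

lemma l1_norm_diff: "l1_norm (p - q) \<le> l1_norm p + l1_norm q"
  using l1_norm_add[of p "- q"] l1_norm_smult[of "-1" q] by simp

lemma l1_norm_mult: "l1_norm (p * q) \<le> l1_norm p * l1_norm q"
proof (induction p)
  case (pCons a p)
  then show ?case
    using l1_norm_add[of "smult a q" "pCons 0 (p * q)"] by (simp add: algebra_simps)
qed simp

lemma l1_norm_power: "l1_norm (p ^ k) \<le> l1_norm p ^ k"
proof (induction k)
  case (Suc k)
  have "l1_norm (p ^ Suc k) \<le> l1_norm p * l1_norm (p ^ k)"
    using l1_norm_mult by simp
  also have "\<dots> \<le> l1_norm p * l1_norm p ^ k"
    by (intro mult_left_mono Suc.IH) simp
  finally show ?case by simp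
qed simp

lemma l1_norm_sum: "l1_norm (\<Sum>i\<in>I. f i) \<le> (\<Sum>i\<in>I. l1_norm (f i))"
proof (induction I rule: infinite_finite_induct)
  case (insert i I)
  then show ?case using l1_norm_add[of "f i" "sum f I"] by simp
qed auto

lemma norm_coeff_le_l1_norm: "cmod (coeff p k) \<le> l1_norm p"
proof (induction p arbitrary: k)
  case (pCons a p)
  then show ?case
    by (cases k) (auto intro: add_increasing add_increasing2)
qed simp

lemma coeff_norm_le_l1_norm: "coeff_norm p \<le> l1_norm p"
  unfolding coeff_norm_def by (subst Max_le_iff) (auto simp: norm_coeff_le_l1_norm)

lemma norm_coeff_le_coeff_norm: "cmod (coeff p k) \<le> coeff_norm p"
proof (cases "k \<le> degree p")
  case True
  then show ?thesis unfolding coeff_norm_def by (intro Max_ge) auto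
next
  case False
  have "0 \<le> cmod (coeff p 0)" by simp
  also have "\<dots> \<le> coeff_norm p" unfolding coeff_norm_def by (intro Max_ge) auto
  finally show ?thesis using False by (simp add: coeff_eq_0)
qed

lemma coeff_norm_nonneg [simp]: "0 \<le> coeff_norm p"
  using norm_coeff_le_coeff_norm[of p 0] norm_ge_zero order_trans by blast

lemma poly_eq_sum_monom_atMost:
  fixes p :: "'a :: comm_semiring_1 poly"
  assumes "degree p \<le> d"
  shows "p = (\<Sum>k\<le>d. smult (coeff p k) (monom 1 k))"
  using poly_as_sum_of_monoms'[OF assms] by (simp add: smult_monom)

lemma l1_norm_monom [simp]: "l1_norm (monom c k) = cmod c"
  by (induction k) (auto simp: monom_0 monom_Suc)

lemma l1_norm_le_coeff_norm:
  assumes "degree p \<le> d"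
  shows "l1_norm p \<le> real (d + 1) * coeff_norm p"
proof -
  have "l1_norm p = l1_norm (\<Sum>k\<le>d. smult (coeff p k) (monom 1 k))"
    using poly_eq_sum_monom_atMost[OF assms] by simp
  also have "\<dots> \<le> (\<Sum>k\<le>d. cmod (coeff p k))"
    using l1_norm_sum[of "\<lambda>k. smult (coeff p k) (monom 1 k)" "{..d}"] by simp
  also have "\<dots> \<le> (\<Sum>k\<le>d. coeff_norm p)"
    by (intro sum_mono norm_coeff_le_coeff_norm)
  finally show ?thesis by simp
qed

section \<open>Bounds for linear maps in bounded degree, and Cauchy-Schwarz\<close>

text \<open>Expanding \<open>p\<close> in monomials reduces the bound to the finitely many images
  \<open>f (monom 1 k)\<close> with \<open>k\<close> at most \<open>d\<close>. It is applied to
  remainder and quotient by \<open>A\<close>, where the constant thus depends only on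
  \<open>A\<close> and \<open>d\<close>.\<close>

lemma linear_map_l1_bound:
  fixes f :: "complex poly \<Rightarrow> complex poly"
  assumes add: "\<And>p q. f (p + q) = f p + f q"
    and smult: "\<And>c p. f (smult c p) = smult c (f p)"
  obtains c where "c \<ge> 0" "\<And>p. degree p \<le> d \<Longrightarrow> l1_norm (f p) \<le> c * l1_norm p"
proof
  let ?c = "\<Sum>k\<le>d. l1_norm (f (monom 1 k))"
  show "?c \<ge> 0" by (intro sum_nonneg) simp
  have f0: "f 0 = 0" using smult[of 0 0] by simp
  have fsum: "f (\<Sum>k\<in>I. g k) = (\<Sum>k\<in>I. f (g k))" for I :: "nat set" and g
    by (induction I rule: infinite_finite_induct) (auto simp: f0 add)
  fix p :: "complex poly" assume "degree p \<le> d"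
  have "f p = f (\<Sum>k\<le>d. smult (coeff p k) (monom 1 k))"
    using poly_eq_sum_monom_atMost[OF \<open>degree p \<le> d\<close>] by simp
  also have "\<dots> = (\<Sum>k\<le>d. smult (coeff p k) (f (monom 1 k)))"
    by (simp add: fsum smult)
  finally have "l1_norm (f p) \<le> (\<Sum>k\<le>d. cmod (coeff p k) * l1_norm (f (monom 1 k)))"
    using l1_norm_sum[of "\<lambda>k. smult (coeff p k) (f (monom 1 k))" "{..d}"] by simp
  also have "\<dots> \<le> (\<Sum>k\<le>d. l1_norm p * l1_norm (f (monom 1 k)))"
    by (intro sum_mono mult_right_mono norm_coeff_le_l1_norm) simp
  finally show "l1_norm (f p) \<le> ?c * l1_norm p"
    by (simp add: sum_distrib_left mult.commute)
qed

text \<open>Needed at one node only, where it turns the lower bound of the theorem into an upper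
  bound for \<delta>.\<close>

lemma norm_poly_le_coeff_norm:
  obtains c where "c \<ge> 0" "\<And>p. degree p \<le> d \<Longrightarrow> cmod (poly p a) \<le> c * coeff_norm p"
proof
  let ?c = "\<Sum>k\<le>d. cmod a ^ k"
  show "?c \<ge> 0" by (intro sum_nonneg) simp
  fix p :: "complex poly" assume "degree p \<le> d"
  have "poly p a = (\<Sum>k\<le>d. coeff p k * a ^ k)"
    by (subst poly_eq_sum_monom_atMost[OF \<open>degree p \<le> d\<close>]) (simp add: poly_sum poly_monom)
  then have "cmod (poly p a) \<le> (\<Sum>k\<le>d. cmod (coeff p k) * cmod a ^ k)"
    using norm_sum[of "\<lambda>k. coeff p k * a ^ k" "{..d}"] by (simp add: norm_mult norm_power)
  also have "\<dots> \<le> (\<Sum>k\<le>d. coeff_norm p * cmod a ^ k)"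
    by (intro sum_mono mult_right_mono norm_coeff_le_coeff_norm) simp
  finally show "cmod (poly p a) \<le> ?c * coeff_norm p"
    by (simp add: sum_distrib_left mult.commute)
qed

text \<open>Cauchy-Schwarz with the second vector in the unit ball. Summing the inequality between
  arithmetic and geometric means for \<open>a j\<close> and \<open>s * b j\<close> and dividing by
  \<open>2 * s\<close> avoids square roots; the division is why \<open>s\<close> must be
  positive.\<close>

lemma sum_mult_le_of_sum_squares:
  fixes a b :: "'i \<Rightarrow> real"
  assumes s: "s > 0" and a: "(\<Sum>j\<in>J. (a j)\<^sup>2) \<le> s\<^sup>2" and b: "(\<Sum>j\<in>J. (b j)\<^sup>2) \<le> 1"
  shows "(\<Sum>j\<in>J. a j * b j) \<le> s"
proof -
  have "2 * s * (\<Sum>j\<in>J. a j * b j) = (\<Sum>j\<in>J. 2 * s * (a j * b j))"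
    by (simp add: sum_distrib_left)
  also have "\<dots> \<le> (\<Sum>j\<in>J. (a j)\<^sup>2 + s\<^sup>2 * (b j)\<^sup>2)"
  proof (rule sum_mono)
    fix j
    show "2 * s * (a j * b j) \<le> (a j)\<^sup>2 + s\<^sup>2 * (b j)\<^sup>2"
      using sum_squares_bound[of "a j" "s * b j"] by (simp add: algebra_simps power_mult_distrib)
  qed
  also have "\<dots> = (\<Sum>j\<in>J. (a j)\<^sup>2) + s\<^sup>2 * (\<Sum>j\<in>J. (b j)\<^sup>2)"
    by (simp add: sum.distrib sum_distrib_left)
  also have "\<dots> \<le> s\<^sup>2 + s\<^sup>2 * 1"
    by (intro add_mono mult_left_mono a b) simp
  finally have "(2 * s) * (\<Sum>j\<in>J. a j * b j) \<le> (2 * s) * s"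
    by (simp add: power2_eq_square)
  then show ?thesis using s by simp
qed

section \<open>Partition of unity for the coprime factors of \<open>A\<close>\<close>

text \<open>A new factor \<open>P x\<close> is coprime to the product of the old ones, so Bezout
  gives \<open>u * P x + v * (\<Prod>k\<in>F. P k) = 1\<close>. The second summand serves as the new
  member, and the old members are multiplied by \<open>u * P x\<close>, so that they sum to the
  first.\<close>

lemma partition_of_unity_coprime:
  fixes P :: "'i \<Rightarrow> 'a :: {euclidean_ring_gcd}"
  assumes "finite I" "I \<noteq> {}"
    and "\<And>i k. i \<in> I \<Longrightarrow> k \<in> I \<Longrightarrow> i \<noteq> k \<Longrightarrow> coprime (P i) (P k)"
  shows "\<exists>e. (\<forall>i\<in>I. (\<Prod>k\<in>I - {i}. P k) dvd e i) \<and> (\<Sum>i\<in>I. e i) = 1"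
  using assms
proof (induction I rule: finite_ne_induct)
  case (singleton x)
  then show ?case by (intro exI[of _ "\<lambda>_. 1"]) simp
next
  case (insert x F)
  then obtain e where e: "\<And>i. i \<in> F \<Longrightarrow> (\<Prod>k\<in>F - {i}. P k) dvd e i" "(\<Sum>i\<in>F. e i) = 1"
    by auto
  have "coprime (P x) (\<Prod>k\<in>F. P k)"
    using insert by (intro prod_coprime_right) auto
  then obtain u v where uv: "u * P x + v * (\<Prod>k\<in>F. P k) = 1"
    using bezout_coefficients_fst_snd[of "P x" "\<Prod>k\<in>F. P k"] by auto
  define e' where "e' i = (if i = x then v * (\<Prod>k\<in>F. P k) else u * P x * e i)" for i
  have "(\<Prod>k\<in>insert x F - {i}. P k) dvd e' i" if i: "i \<in> insert x F" for i
  proof (cases "i = x")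
    case True
    then show ?thesis using insert by (simp add: e'_def)
  next
    case False
    then have "insert x F - {i} = insert x (F - {i})" by auto
    then have "(\<Prod>k\<in>insert x F - {i}. P k) = P x * (\<Prod>k\<in>F - {i}. P k)"
      using insert by simp
    moreover have "P x * (\<Prod>k\<in>F - {i}. P k) dvd (P x * e i) * u"
      using e False i by (intro dvd_mult2 mult_dvd_mono) auto
    ultimately show ?thesis using False by (simp add: e'_def mult_ac)
  qed
  moreover have "(\<Sum>i\<in>insert x F. e' i) = 1"
  proof -
    have "(\<Sum>i\<in>F. e' i) = (\<Sum>i\<in>F. u * P x * e i)"
      using insert by (intro sum.cong) (auto simp: e'_def)
    also have "\<dots> = u * P x" by (simp add: e flip: sum_distrib_left)
    finally show ?thesis using insert uv by (simp add: e'_def add.commute)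
  qed
  ultimately show ?case by blast
qed

text \<open>The two linear factors differ by a nonzero constant, so every common divisor is a unit;
  coprimality passes to powers.\<close>

lemma coprime_linear_powers:
  fixes a b :: complex
  assumes "a \<noteq> b"
  shows "coprime ([:- a, 1:] ^ k) ([:- b, 1:] ^ l)"
proof -
  have "[:- a, 1:] - [:- b, 1:] = [:b - a:]" by simp
  moreover have "is_unit [:b - a:]"
    using assms by (simp add: is_unit_const_poly_iff dvd_field_iff)
  ultimately have "coprime [:- a, 1:] [:- b, 1:]"
    by (intro coprimeI) (metis dvd_diff dvd_unit_imp_unit)
  then show ?thesis by simp
qed

section \<open>The combination of the \<open>B j\<close> with value 1 at a node\<close>

text \<open>The chosen \<open>c\<close> is the solution of least l2 norm, with squared norm exactly
  \<open>1 / \<beta>\<close>. Cauchy-Schwarz against the coefficient norms then bounds the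
  combination independently of the size of \<open>J\<close>; the factor \<open>K + 1\<close> is the
  cost of passing from \<open>coeff_norm\<close> to \<open>l1_norm\<close>.\<close>

lemma normalised_combination_at_point:
  fixes B :: "'i \<Rightarrow> complex poly"
  assumes \<delta>: "\<delta> > 0"
    and deg: "\<And>j. j \<in> J \<Longrightarrow> degree (B j) \<le> K"
    and norm: "(\<Sum>j\<in>J. (coeff_norm (B j))\<^sup>2) \<le> 1"
    and lower: "\<delta>\<^sup>2 \<le> (\<Sum>j\<in>J. (cmod (poly (B j) a))\<^sup>2)"
  shows "\<exists>c. poly (\<Sum>j\<in>J. smult (c j) (B j)) a = 1 \<and> (\<Sum>j\<in>J. (cmod (c j))\<^sup>2) \<le> (1 / \<delta>)\<^sup>2 \<and>
             l1_norm (\<Sum>j\<in>J. smult (c j) (B j)) \<le> real (K + 1) / \<delta>"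
proof -
  define \<beta> where "\<beta> = (\<Sum>j\<in>J. (cmod (poly (B j) a))\<^sup>2)"
  define c where "c j = cnj (poly (B j) a) / of_real \<beta>" for j
  have \<beta>: "\<beta> > 0" "\<delta>\<^sup>2 \<le> \<beta>"
    using lower \<delta> zero_less_power[OF \<delta>, of 2] unfolding \<beta>_def by linarith+
  have "poly (\<Sum>j\<in>J. smult (c j) (B j)) a = (\<Sum>j\<in>J. complex_of_real ((cmod (poly (B j) a))\<^sup>2)) / of_real \<beta>"
    unfolding complex_norm_square by (simp add: poly_sum c_def sum_divide_distrib mult.commute)
  also have "\<dots> = 1" using \<beta> by (simp add: \<beta>_def flip: of_real_sum of_real_power)
  finally have one: "poly (\<Sum>j\<in>J. smult (c j) (B j)) a = 1" .
  have "(\<Sum>j\<in>J. (cmod (c j))\<^sup>2) = (\<Sum>j\<in>J. (cmod (poly (B j) a))\<^sup>2) / \<beta>\<^sup>2"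
    by (simp add: c_def norm_divide power_divide sum_divide_distrib)
  also have "\<dots> = 1 / \<beta>"
    unfolding \<beta>_def[symmetric] using \<beta> by (simp add: power2_eq_square)
  also have "\<dots> \<le> (1 / \<delta>)\<^sup>2" using \<beta> \<delta> by (simp add: power_divide frac_le)
  finally have c: "(\<Sum>j\<in>J. (cmod (c j))\<^sup>2) \<le> (1 / \<delta>)\<^sup>2" .
  have "l1_norm (\<Sum>j\<in>J. smult (c j) (B j)) \<le> (\<Sum>j\<in>J. cmod (c j) * l1_norm (B j))"
    using l1_norm_sum[of "\<lambda>j. smult (c j) (B j)" J] by simp
  also have "\<dots> \<le> (\<Sum>j\<in>J. cmod (c j) * (real (K + 1) * coeff_norm (B j)))"
    by (intro sum_mono mult_left_mono l1_norm_le_coeff_norm deg) auto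
  also have "\<dots> = real (K + 1) * (\<Sum>j\<in>J. cmod (c j) * coeff_norm (B j))"
    by (simp add: sum_distrib_left mult_ac)
  also have "\<dots> \<le> real (K + 1) * (1 / \<delta>)"
    using \<delta> c norm by (intro mult_left_mono sum_mult_le_of_sum_squares) auto
  finally show ?thesis using one c by auto
qed

section \<open>Gluing the local solutions with uniform constants\<close>

theorem theorem4p2:
  fixes A :: "complex poly" and \<alpha> :: "nat \<Rightarrow> complex" and m :: "nat \<Rightarrow> nat"
    and n N K :: nat
  assumes A: "A = (\<Prod>j=1..n. [:- \<alpha> j, 1:] ^ m j)"
    and distinct: "inj_on \<alpha> {1..n}"
    and m_pos: "\<And>j. j \<in> {1..n} \<Longrightarrow> m j > 0"
    and N: "N = (\<Sum>j=1..n. m j)" "N \<ge> 1"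
  shows "\<exists>C>0. \<forall>L\<ge>1. \<forall>\<delta>>0. \<forall>B :: nat \<Rightarrow> complex poly.
           (\<forall>j\<in>{1..L}. B j \<in> poly_space (int K)) \<longrightarrow>
           (\<Sum>j=1..L. (coeff_norm (B j))\<^sup>2) \<le> 1 \<longrightarrow>
           (\<forall>i\<in>{1..n}. (\<Sum>j=1..L. (cmod (poly (B j) (\<alpha> i)))\<^sup>2) \<ge> \<delta>\<^sup>2) \<longrightarrow>
           (\<exists>R S. R \<in> poly_space (int K - 1) \<and>
              (\<forall>j\<in>{1..L}. S j \<in> poly_space (int N - 1)) \<and>
              R * A + (\<Sum>j=1..L. S j * B j) = 1 \<and>
              sqrt ((coeff_norm R)\<^sup>2 + (\<Sum>j=1..L. (coeff_norm (S j))\<^sup>2))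
                \<le> C / \<delta> ^ Max (m ` {1..n}))"
proof -
  have n: "n \<ge> 1" using N by (cases n) auto
  define M where "M = Max (m ` {1..n})"
  have mM: "m i \<le> M" if "i \<in> {1..n}" for i
    unfolding M_def using that by (intro Max_ge) auto
  have M: "M \<ge> 1" using m_pos[of 1] mM[of 1] n by simp
  define P where "P i = [:- \<alpha> i, 1:] ^ m i" for i
  have A_P: "A = (\<Prod>i=1..n. P i)" by (simp add: A P_def)
  have degA: "degree A = N" and A0: "A \<noteq> 0"
    unfolding A N(1) by (auto simp: degree_prod_eq_sum_degree degree_power_eq)
  have "\<exists>e. (\<forall>i\<in>{1..n}. (\<Prod>k\<in>{1..n} - {i}. P k) dvd e i) \<and> (\<Sum>i=1..n. e i) = 1"
  proof (rule partition_of_unity_coprime)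
    fix i k assume "i \<in> {1..n}" "k \<in> {1..n}" "i \<noteq> k"
    then show "coprime (P i) (P k)"
      unfolding P_def using distinct by (intro coprime_linear_powers) (auto dest: inj_onD)
  qed (use n in auto)
  then obtain e where e_dvd: "\<And>i. i \<in> {1..n} \<Longrightarrow> (\<Prod>k\<in>{1..n} - {i}. P k) dvd e i"
    and e_sum: "(\<Sum>i=1..n. e i) = 1" by blast
  have A_dvd: "A dvd e i * p" if "i \<in> {1..n}" "P i dvd p" for i p
  proof -
    have "A = (\<Prod>k\<in>{1..n} - {i}. P k) * P i"
      using that(1) unfolding A_P by (subst prod.remove[of _ i]) (auto simp: mult.commute)
    then show ?thesis using mult_dvd_mono[OF e_dvd[OF that(1)] that(2)] by simp
  qed
  \<comment> \<open>All constants are fixed before \<open>L\<close>, \<delta> and \<open>B\<close>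
    appear. This \<open>d\<close> bounds the degree of every \<open>G i\<close> below: the Neumann
    powers have exponent at most \<open>M\<close> and base of degree at most
    \<open>K\<close>.\<close>
  define d where "d = (\<Sum>i=1..n. degree (e i)) + K * M"
  have mod_add: "(p + q) mod A = p mod A + q mod A" for p q by (rule poly_mod_add_left)
  have mod_smult: "smult c p mod A = smult c (p mod A)" for c p by (rule mod_smult_left)
  obtain cm where cm: "cm \<ge> 0" "\<And>p. degree p \<le> d \<Longrightarrow> l1_norm (p mod A) \<le> cm * l1_norm p"
    using linear_map_l1_bound[of "\<lambda>p. p mod A" d, OF mod_add mod_smult] by metis
  have div_add: "(p + q) div A = p div A + q div A" for p q by (rule poly_div_add_left)
  have div_smult: "smult c p div A = smult c (p div A)" for c p by (rule div_smult_left)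
  \<comment> \<open>The degree bound covers \<open>1 - (\<Sum>j=1..L. S j * B j)\<close>, whose
    quotient by \<open>A\<close> will be \<open>R\<close>.\<close>
  obtain cd where cd: "cd \<ge> 0" "\<And>p. degree p \<le> N + K \<Longrightarrow> l1_norm (p div A) \<le> cd * l1_norm p"
    using linear_map_l1_bound[of "\<lambda>p. p div A" "N + K", OF div_add div_smult] by metis
  obtain D where D: "D \<ge> 0" "\<And>p. degree p \<le> K \<Longrightarrow> cmod (poly p (\<alpha> 1)) \<le> D * coeff_norm p"
    using norm_poly_le_coeff_norm[of K "\<alpha> 1"] by metis
  \<comment> \<open>Chosen so that \<open>E / \<delta>\<close> dominates
    \<open>1 + real (K + 1) / \<delta>\<close> as soon as \<delta> is at most
    \<open>D\<close>.\<close>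
  define E where "E = D + real (K + 1)"
  define g where "g = (\<Sum>i=1..n. cm * l1_norm (e i) * real M)"
  \<comment> \<open>The added 1 keeps \<open>h\<close> positive even if \<open>g\<close> is 0, as
    the Cauchy-Schwarz lemma requires.\<close>
  define h where "h = real n * g + 1"
  define C where "C = (cd * (1 + real (K + 1) * h) + h) * E ^ M"
  have E: "E \<ge> 1" using D by (simp add: E_def)
  have g: "g \<ge> 0" unfolding g_def using cm by (intro sum_nonneg) simp
  have h: "h > 0" unfolding h_def using g by (simp add: add_nonneg_pos)
  have "cd * (1 + real (K + 1) * h) + h > 0"
    using cd(1) h by (intro add_nonneg_pos mult_nonneg_nonneg) auto
  then have C: "C > 0" using E by (simp add: C_def)
  show ?thesis
  proof (intro exI[of _ C] conjI C allI impI)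
    fix L :: nat and \<delta> :: real and B :: "nat \<Rightarrow> complex poly"
    assume \<delta>: "\<delta> > 0" and B: "\<forall>j\<in>{1..L}. B j \<in> poly_space (int K)"
      and normB: "(\<Sum>j=1..L. (coeff_norm (B j))\<^sup>2) \<le> 1"
      and lower: "\<forall>i\<in>{1..n}. (\<Sum>j=1..L. (cmod (poly (B j) (\<alpha> i)))\<^sup>2) \<ge> \<delta>\<^sup>2"
    have degB: "degree (B j) \<le> K" if "j \<in> {1..L}" for j
      using bspec[OF B that] by (auto simp: poly_space_def)
    have "\<delta>\<^sup>2 \<le> (\<Sum>j=1..L. (cmod (poly (B j) (\<alpha> 1)))\<^sup>2)" using lower n by auto
    also have "\<dots> \<le> (\<Sum>j=1..L. (D * coeff_norm (B j))\<^sup>2)"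
      by (intro sum_mono power_mono D degB) auto
    also have "\<dots> = D\<^sup>2 * (\<Sum>j=1..L. (coeff_norm (B j))\<^sup>2)"
      by (simp add: power_mult_distrib sum_distrib_left)
    also have "\<dots> \<le> D\<^sup>2 * 1" by (intro mult_left_mono normB) simp
    finally have "\<delta> \<le> D" using D(1) power2_le_imp_le by fastforce
    \<comment> \<open>The hypotheses force \<open>\<delta> \<le> D\<close>, so \<open>x \<ge> 1\<close> and lower powers of \<open>1 / \<delta>\<close> are absorbed
      by \<open>x ^ M\<close>.\<close>
    define x where "x = E / \<delta>"
    have x_bound: "1 + real (K + 1) / \<delta> \<le> x"
      using \<open>\<delta> \<le> D\<close> \<delta> by (simp add: x_def E_def field_simps)
    have x1: "x \<ge> 1" using x_bound \<delta> by (smt (verit) divide_nonneg_pos of_nat_0_le_iff)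
    have inv_x: "1 / \<delta> \<le> x" using E \<delta> by (simp add: x_def divide_right_mono)
    have "\<forall>i\<in>{1..n}. \<exists>c. poly (\<Sum>j=1..L. smult (c j) (B j)) (\<alpha> i) = 1 \<and>
             (\<Sum>j=1..L. (cmod (c j))\<^sup>2) \<le> (1 / \<delta>)\<^sup>2 \<and>
             l1_norm (\<Sum>j=1..L. smult (c j) (B j)) \<le> real (K + 1) / \<delta>"
      using lower by (intro ballI normalised_combination_at_point \<delta> degB normB) auto
    from bchoice[OF this] obtain c where c:
      "\<forall>i\<in>{1..n}. poly (\<Sum>j=1..L. smult (c i j) (B j)) (\<alpha> i) = 1 \<and>
             (\<Sum>j=1..L. (cmod (c i j))\<^sup>2) \<le> (1 / \<delta>)\<^sup>2 \<and>
             l1_norm (\<Sum>j=1..L. smult (c i j) (B j)) \<le> real (K + 1) / \<delta>"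
      by blast
    define T where "T i = (\<Sum>j=1..L. smult (c i j) (B j))" for i
    define G where "G i = e i * (\<Sum>k<m i. (1 - T i) ^ k)" for i
    define S where "S j = (\<Sum>i=1..n. smult (c i j) (G i mod A))" for j
    define R where "R = (1 - (\<Sum>j=1..L. S j * B j)) div A"
    have degT: "degree (1 - T i) \<le> K" for i
      unfolding T_def by (intro degree_diff_le degree_sum_le) (auto intro: degree_smult_le[THEN order_trans] degB)
    have degG: "degree (G i) \<le> d" if i: "i \<in> {1..n}" for i
    proof -
      have "degree (\<Sum>k<m i. (1 - T i) ^ k) \<le> K * M"
      proof (intro degree_sum_le)
        fix k assume "k \<in> {..<m i}"
        then have "k \<le> M" using mM[OF i] by simp
        have "degree ((1 - T i) ^ k) \<le> degree (1 - T i) * k" by (rule degree_power_le)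
        also have "\<dots> \<le> K * M" by (intro mult_le_mono degT \<open>k \<le> M\<close>)
        finally show "degree ((1 - T i) ^ k) \<le> K * M" .
      qed auto
      moreover have "degree (e i) \<le> (\<Sum>i=1..n. degree (e i))"
        using i by (intro member_le_sum) auto
      ultimately show ?thesis
        unfolding G_def d_def using degree_mult_le[of "e i" "\<Sum>k<m i. (1 - T i) ^ k"] by linarith
    qed
    have normG: "l1_norm (G i mod A) \<le> g * x ^ (M - 1)" if i: "i \<in> {1..n}" for i
    proof -
      have "l1_norm (1 - T i) \<le> x"
        using l1_norm_diff[of 1 "T i"] c i x_bound by (force simp: T_def)
      \<comment> \<open>The exponents stop at \<open>m i - 1\<close>, so the Neumann sum costs only
        \<open>x ^ (M - 1)\<close>; the last factor comes from the coefficients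
        \<open>c i j\<close>.\<close>
      then have pow: "l1_norm ((1 - T i) ^ k) \<le> x ^ (M - 1)" if "k < m i" for k
        using l1_norm_power[of "1 - T i" k] power_mono[of "l1_norm (1 - T i)" x k]
          power_increasing[of k "M - 1" x] x1 that mM[OF i] by force
      have "l1_norm (\<Sum>k<m i. (1 - T i) ^ k) \<le> (\<Sum>k<m i. l1_norm ((1 - T i) ^ k))"
        by (rule l1_norm_sum)
      also have "\<dots> \<le> real (m i) * x ^ (M - 1)"
        using sum_bounded_above[of "{..<m i}" "\<lambda>k. l1_norm ((1 - T i) ^ k)" "x ^ (M - 1)"] pow by auto
      also have "\<dots> \<le> real M * x ^ (M - 1)"
        using mM[OF i] x1 by (intro mult_right_mono) auto
      finally have "l1_norm (\<Sum>k<m i. (1 - T i) ^ k) \<le> real M * x ^ (M - 1)" .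
      then have "l1_norm (G i) \<le> l1_norm (e i) * (real M * x ^ (M - 1))"
        unfolding G_def using l1_norm_mult mult_left_mono l1_norm_nonneg order_trans by metis
      then have "cm * l1_norm (G i) \<le> cm * (l1_norm (e i) * (real M * x ^ (M - 1)))"
        using cm(1) by (rule mult_left_mono)
      then have "l1_norm (G i mod A) \<le> cm * l1_norm (e i) * real M * x ^ (M - 1)"
        using cm(2)[OF degG[OF i]] by (simp add: mult.assoc)
      also have "\<dots> \<le> g * x ^ (M - 1)"
        unfolding g_def using i cm x1 by (intro mult_right_mono member_le_sum) auto
      finally show ?thesis .
    qed
    \<comment> \<open>Cauchy-Schwarz over the \<open>n\<close> nodes keeps the squares of the
      \<open>c i j\<close> intact. Their sum over \<open>j\<close> is at most
      \<open>(1 / \<delta>)\<^sup>2\<close> for each node, so \<open>L\<close> does not enter the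
      bound.\<close>
    have S_l1: "(l1_norm (S j))\<^sup>2 \<le> (g * x ^ (M - 1))\<^sup>2 * (real n * (\<Sum>i=1..n. (cmod (c i j))\<^sup>2))" for j
    proof -
      have "l1_norm (S j) \<le> (\<Sum>i=1..n. cmod (c i j) * l1_norm (G i mod A))"
        unfolding S_def using l1_norm_sum[of "\<lambda>i. smult (c i j) (G i mod A)" "{1..n}"] by simp
      also have "\<dots> \<le> (\<Sum>i=1..n. cmod (c i j) * (g * x ^ (M - 1)))"
        by (intro sum_mono mult_left_mono normG) auto
      also have "\<dots> = g * x ^ (M - 1) * (\<Sum>i=1..n. cmod (c i j))"
        by (simp add: sum_distrib_left mult_ac)
      finally have "(l1_norm (S j))\<^sup>2 \<le> (g * x ^ (M - 1) * (\<Sum>i=1..n. cmod (c i j)))\<^sup>2"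
        by (intro power_mono) auto
      also have "\<dots> = (g * x ^ (M - 1))\<^sup>2 * (\<Sum>i=1..n. cmod (c i j))\<^sup>2"
        by (rule power_mult_distrib)
      also have "\<dots> \<le> (g * x ^ (M - 1))\<^sup>2 * (real n * (\<Sum>i=1..n. (cmod (c i j))\<^sup>2))"
        using sum_squared_le_sum_of_squares[of "\<lambda>i. cmod (c i j)" "{1..n}"]
        by (intro mult_left_mono) (auto simp: mult.commute)
      finally show ?thesis .
    qed
    have "(\<Sum>j=1..L. (l1_norm (S j))\<^sup>2)
        \<le> (\<Sum>j=1..L. (g * x ^ (M - 1))\<^sup>2 * (real n * (\<Sum>i=1..n. (cmod (c i j))\<^sup>2)))"
      by (intro sum_mono S_l1)
    also have "\<dots> = (g * x ^ (M - 1))\<^sup>2 * (real n * (\<Sum>i=1..n. \<Sum>j=1..L. (cmod (c i j))\<^sup>2))"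
      by (subst sum.swap) (simp add: sum_distrib_left)
    also have "\<dots> \<le> (g * x ^ (M - 1))\<^sup>2 * (real n * (\<Sum>i=1..n. (1 / \<delta>)\<^sup>2))"
      using c by (intro mult_left_mono sum_mono) auto
    also have "\<dots> = (g * x ^ (M - 1) * real n * (1 / \<delta>))\<^sup>2"
      by (simp add: power2_eq_square)
    also have "\<dots> \<le> (h * x ^ M)\<^sup>2"
    proof (intro power_mono)
      have "g * x ^ (M - 1) * real n * (1 / \<delta>) \<le> g * x ^ (M - 1) * real n * x"
        using g x1 inv_x by (intro mult_left_mono) auto
      also have "\<dots> = real n * g * x ^ M"
        using M by (cases M) auto
      also have "\<dots> \<le> h * x ^ M"
        using x1 by (intro mult_right_mono) (auto simp: h_def)
      finally show "g * x ^ (M - 1) * real n * (1 / \<delta>) \<le> h * x ^ M" .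
    qed (use g x1 \<delta> in auto)
    finally have S_bound: "(\<Sum>j=1..L. (l1_norm (S j))\<^sup>2) \<le> (h * x ^ M)\<^sup>2" .
    have degS: "degree (S j) \<le> N - 1" for j
    proof -
      have "degree (G i mod A) \<le> N - 1" for i
        using degree_mod_less[OF A0, of "G i"] degA by auto
      then show ?thesis
        unfolding S_def by (intro degree_sum_le) (auto intro: degree_smult_le[THEN order_trans])
    qed
    have dvd: "A dvd 1 - (\<Sum>j=1..L. S j * B j)"
    proof -
      have "(\<Sum>j=1..L. S j * B j) = (\<Sum>j=1..L. \<Sum>i=1..n. (G i mod A) * smult (c i j) (B j))"
        by (simp add: S_def sum_distrib_right)
      also have "\<dots> = (\<Sum>i=1..n. (G i mod A) * T i)"
        by (subst sum.swap) (simp add: T_def sum_distrib_left)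
      \<comment> \<open>Each summand splits into the error of the truncated Neumann series and the
        error of reducing \<open>G i\<close> modulo \<open>A\<close>; both are multiples of
        \<open>A\<close>.\<close>
      finally have "1 - (\<Sum>j=1..L. S j * B j)
          = (\<Sum>i=1..n. (e i - G i * T i) + (G i - G i mod A) * T i)"
        using e_sum by (simp add: sum.distrib sum_subtractf algebra_simps)
      moreover have "A dvd e i - G i * T i" if i: "i \<in> {1..n}" for i
      proof -
        \<comment> \<open>Writing \<open>T i\<close> as \<open>1 - (1 - T i)\<close> exposes the
          finite geometric sum, which telescopes to leave \<open>(1 - T i) ^ m i\<close>.\<close>
        have "e i - G i * T i = e i * (1 - (1 - (1 - T i)) * (\<Sum>k<m i. (1 - T i) ^ k))"
          by (simp add: G_def algebra_simps)
        also have "\<dots> = e i * (1 - T i) ^ m i"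
          by (subst one_diff_power_eq[symmetric]) simp
        finally have eq: "e i - G i * T i = e i * (1 - T i) ^ m i" .
        have "[:- \<alpha> i, 1:] dvd 1 - T i"
          using c i by (simp add: poly_eq_0_iff_dvd[symmetric] T_def)
        then show ?thesis
          unfolding eq by (intro A_dvd[OF i]) (simp add: P_def dvd_power_same)
      qed
      moreover have "A dvd (G i - G i mod A) * T i" for i
        by (simp add: minus_mod_eq_mult_div)
      ultimately show ?thesis by (auto intro!: dvd_sum dvd_add)
    qed
    then have RA: "R * A = 1 - (\<Sum>j=1..L. S j * B j)" by (simp add: R_def)
    have degSB: "degree (1 - (\<Sum>j=1..L. S j * B j)) \<le> N - 1 + K"
    proof (intro degree_diff_le degree_sum_le)
      fix j assume "j \<in> {1..L}"
      then show "degree (S j * B j) \<le> N - 1 + K"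
        using degree_mult_le[of "S j" "B j"] degS[of j] degB[of j] by linarith
    qed auto
    have R_deg: "R \<in> poly_space (int K - 1)"
    proof (cases "R = 0")
      case False
      \<comment> \<open>For nonzero \<open>R\<close> degrees add, so \<open>degree R + N\<close> is
        at most \<open>N - 1 + K\<close>. If \<open>K\<close> is 0 this is impossible, which leaves
        only \<open>R = 0\<close>, as \<open>poly_space (- 1)\<close> demands.\<close>
      then have "degree R + N = degree (1 - (\<Sum>j=1..L. S j * B j))"
        unfolding RA[symmetric] using A0 degA by (simp add: degree_mult_eq)
      then have "degree R < K" using degSB N(2) by linarith
      then show ?thesis by (simp add: poly_space_def)
    qed (simp add: poly_space_def)
    have xM: "1 \<le> x ^ M" using x1 by (rule one_le_power)
    have hx: "h * x ^ M > 0" using h x1 by simp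
    have "l1_norm (\<Sum>j=1..L. S j * B j) \<le> (\<Sum>j=1..L. l1_norm (S j * B j))"
      by (rule l1_norm_sum)
    also have "\<dots> \<le> (\<Sum>j=1..L. l1_norm (S j) * l1_norm (B j))"
      by (intro sum_mono l1_norm_mult)
    also have "\<dots> \<le> (\<Sum>j=1..L. l1_norm (S j) * (real (K + 1) * coeff_norm (B j)))"
      by (intro sum_mono mult_left_mono l1_norm_le_coeff_norm degB) auto
    also have "\<dots> = real (K + 1) * (\<Sum>j=1..L. l1_norm (S j) * coeff_norm (B j))"
      by (simp add: sum_distrib_left mult_ac)
    \<comment> \<open>The l2 bounds on the \<open>S j\<close> and the \<open>B j\<close> combine by
      Cauchy-Schwarz, so the estimate for \<open>R\<close> is again free of
      \<open>L\<close>.\<close>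
    also have "\<dots> \<le> real (K + 1) * (h * x ^ M)"
      by (intro mult_left_mono sum_mult_le_of_sum_squares[OF hx S_bound normB]) simp
    finally have "l1_norm (1 - (\<Sum>j=1..L. S j * B j)) \<le> x ^ M + real (K + 1) * (h * x ^ M)"
      using l1_norm_diff[of 1 "\<Sum>j=1..L. S j * B j"] xM by simp
    then have "cd * l1_norm (1 - (\<Sum>j=1..L. S j * B j)) \<le> cd * (x ^ M + real (K + 1) * (h * x ^ M))"
      using cd(1) by (rule mult_left_mono)
    moreover have "l1_norm R \<le> cd * l1_norm (1 - (\<Sum>j=1..L. S j * B j))"
      unfolding R_def using degSB by (intro cd(2)) simp
    ultimately have R_bound: "coeff_norm R \<le> cd * (1 + real (K + 1) * h) * x ^ M"
      using coeff_norm_le_l1_norm[of R] by (simp add: algebra_simps)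
    have "(\<Sum>j=1..L. (coeff_norm (S j))\<^sup>2) \<le> (\<Sum>j=1..L. (l1_norm (S j))\<^sup>2)"
      by (intro sum_mono power_mono coeff_norm_le_l1_norm) simp
    also note S_bound
    finally have "sqrt (\<Sum>j=1..L. (coeff_norm (S j))\<^sup>2) \<le> h * x ^ M"
      using hx by (intro real_le_lsqrt) (auto intro: sum_nonneg)
    moreover have "sqrt ((coeff_norm R)\<^sup>2 + (\<Sum>j=1..L. (coeff_norm (S j))\<^sup>2))
        \<le> sqrt ((coeff_norm R)\<^sup>2) + sqrt (\<Sum>j=1..L. (coeff_norm (S j))\<^sup>2)"
      by (intro sqrt_add_le_add_sqrt sum_nonneg) auto
    ultimately have "sqrt ((coeff_norm R)\<^sup>2 + (\<Sum>j=1..L. (coeff_norm (S j))\<^sup>2))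
        \<le> cd * (1 + real (K + 1) * h) * x ^ M + h * x ^ M"
      using R_bound by simp
    \<comment> \<open>The factor \<open>E ^ M\<close> in \<open>C\<close> comes from
      \<open>x ^ M = E ^ M / \<delta> ^ M\<close>.\<close>
    also have "\<dots> = C / \<delta> ^ M"
      by (simp add: C_def x_def power_divide add_divide_distrib distrib_right)
    finally have bound: "sqrt ((coeff_norm R)\<^sup>2 + (\<Sum>j=1..L. (coeff_norm (S j))\<^sup>2))
        \<le> C / \<delta> ^ Max (m ` {1..n})" by (simp add: M_def)
    have "\<forall>j\<in>{1..L}. S j \<in> poly_space (int N - 1)"
    proof
      fix j
      have "int (degree (S j)) \<le> int N - 1" using degS[of j] N(2) by linarith
      then show "S j \<in> poly_space (int N - 1)" by (simp add: poly_space_def)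
    qed
    then show "\<exists>R S. R \<in> poly_space (int K - 1) \<and>
              (\<forall>j\<in>{1..L}. S j \<in> poly_space (int N - 1)) \<and>
              R * A + (\<Sum>j=1..L. S j * B j) = 1 \<and>
              sqrt ((coeff_norm R)\<^sup>2 + (\<Sum>j=1..L. (coeff_norm (S j))\<^sup>2))
                \<le> C / \<delta> ^ Max (m ` {1..n})"
      using R_deg RA bound by (intro exI[of _ R] exI[of _ S]) simp
  qed
qed

end
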